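(* There exists a family of pairwise distinct homotopy classes $H^{p,q}$ of virtual knots, indexed by all ordered pairs $(p,q)$ of distinct positive integers (in particular there are infinitely many of them), such that each $H^{p,q}$ contains an infinite sequence of pairwise distinct virtual knots $\{K^{p,q}_j\}_{j=0}^{\infty}$ with $\mathrm{vb}(K^{p,q}_j)=1$ for all $j\ge 0$ and $\mathrm{rvu}(K^{p,q}_{j_1},K^{p,q}_{j_2})=|j_1-j_2|$ for all $j_1,j_2\ge 0$.
   Context: **Gauss diagrams.** A Gauss diagram is an oriented circle together with a finite (possibly empty) set of chords with pairwise distinct endpoints on the circle. Each chord is oriented (an arrow from its tail to its head) and carries a sign $+1$ or $-1$. Gauss diagrams are considered up to orientation-preserving homeomorphism of the circle preserving the chords with their orientations and signs. For the Gauss diagram of an oriented knot diagram, the chords join the two preimages of each crossing, are oriented from the overpass to the underpass, and carry the sign of the crossing. Arbitrary Gauss diagrams are allowed; they need not come from a knot diagram in the plane. **Reidemeister moves on Gauss diagrams** (each move and its inverse). Two or more endpoints are "adjacent" if they lie on an arc of the circle containing no other chord endpoints. (R1) Add or delete a chord of any orientation and sign whose two endpoints are adjacent. (R2) Add or delete two chords of opposite signs whose tails are adjacent to each other and whose heads are adjacent to each other (the relative order of the two chords on the tail arc and on the head arc is arbitrary). (R3) The Gauss diagram version of the planar third Reidemeister move. Suppose there are three disjoint arcs $T,M,B$ of the circle (top, middle, bottom strands) and three chords $c_{TM},c_{TB},c_{MB}$, where $c_{XY}$ has tail on $X$ and head on $Y$, such that these arcs contain no other chord endpoints. Simultaneously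 exchange the order of the two endpoints on each of the three arcs, leaving orientations and signs of chords unchanged. The move is allowed exactly for the configurations that arise from three oriented strands in the plane. Explicitly: let $\varepsilon_{XY}$ be the sign of $c_{XY}$; let $o_T=+1$ if the endpoint of $c_{TM}$ precedes that of $c_{TB}$ on $T$ and $-1$ otherwise; let $o_M=+1$ if the endpoint of $c_{TM}$ precedes that of $c_{MB}$ on $M$ and $-1$ otherwise; let $o_B=+1$ if the endpoint of $c_{TB}$ precedes that of $c_{MB}$ on $B$ and $-1$ otherwise. The move is allowed if for some $P\in\{+1,-1\}$ one has $o_M=P\varepsilon_{TM}$, $o_B=P\varepsilon_{TB}$, $o_T=P\varepsilon_{TM}\varepsilon_{TB}\varepsilon_{MB}$. **Virtual knots.** An isotopy between two Gauss diagrams is a finite sequence of the Reidemeister moves (R1), (R2), (R3) on Gauss diagrams and their inverses. A virtual knot is an equivalence class of Gauss diagrams under isotopy; a diagram in the class is said to realize the virtual knot. **Homotopy.** A flip move on a chord simultaneously reverses the direction of the chord and changes its sign. A (generic) homotopy between two Gauss diagrams is a finite sequence of Reidemeister moves and flip moves. Two virtual knots are homotopic if diagrams realizing them are related by a homotopy; a homotopy class is an equivalence class of virtual knots under this relation. **Virtual bridge number.** The number of bridges of a Gauss diagram is the number of arcs of the circle between two consecutive arrow heads that contain at least one arrow tail (if there is exactly one chord, the complement of its head counts as such an arc, so there is one bridge; the trivial diagram with no chords has $0$ bridges). The virtual bridge number $\mathrm{vb}(K)$ is the minimum number of bridges over all Gauss diagrams realizing the virtual knot $K$. **Relative unknotting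 number.** For two homotopic virtual knots $K_1,K_2$, $\mathrm{rvu}(K_1,K_2)$ is the minimal number of flip moves in a homotopy of $K_1$ to $K_2$ (so $\mathrm{rvu}(K,K)=0$). *)

theory Defs
  imports Main
begin

text \<open>
  A Gauss diagram is encoded by cutting the circle open at a point that is not an endpoint: the
  list records the endpoints in the order met along the oriented circle, and the function
  gives the signs. Chords carry arbitrary natural-number names; the values of the sign function
  at unused names are irrelevant. The choices of cut point and of names are removed by
  \<open>gauss_iso\<close> below.
\<close>

datatype 'c endpoint = is_tail: Tail 'c | is_head: Head 'c

type_synonym diagram = "nat endpoint list \<times> (nat \<Rightarrow> int)"

definition chords :: "'c endpoint list \<Rightarrow> 'c set" where
  "chords w = (\<Union>x\<in>set w. set_endpoint x)"

definition gauss_diagrams :: "diagram set" where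
  "gauss_diagrams = {(w, s). distinct w \<and> (\<forall>c. Tail c \<in> set w \<longleftrightarrow> Head c \<in> set w) \<and>
     (\<forall>c\<in>chords w. s c = 1 \<or> s c = -1)}"

text \<open>Orientation-preserving homeomorphisms of the circle preserving chords, directions and signs.\<close>

definition gauss_iso :: "diagram \<Rightarrow> diagram \<Rightarrow> bool" where
  "gauss_iso D D' \<longleftrightarrow> (case (D, D') of ((w, s), (w', s')) \<Rightarrow>
     \<exists>k f. inj_on f (chords w) \<and> w' = rotate k (map (map_endpoint f) w) \<and>
       (\<forall>c\<in>chords w. s' (f c) = s c))"

text \<open>
  The moves below are stated for one convenient choice of the cut point and of the chord names.
  They are always combined with \<open>gauss_iso\<close> and restricted to \<open>gauss_diagrams\<close>;
  this restriction forces added chords to have new names and signs \<open>1\<close> or \<open>-1\<close>.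
\<close>

inductive R1 :: "diagram \<Rightarrow> diagram \<Rightarrow> bool" where
  "R1 (u @ v, s) (u @ [Tail c, Head c] @ v, s(c := e))"
| "R1 (u @ v, s) (u @ [Head c, Tail c] @ v, s(c := e))"

inductive R2 :: "diagram \<Rightarrow> diagram \<Rightarrow> bool" where
  "R2 (u @ v @ w, s)
      (u @ [Tail a, Tail b] @ v @ [Head a, Head b] @ w, s(a := e, b := - e))"
| "R2 (u @ v @ w, s)
      (u @ [Tail a, Tail b] @ v @ [Head b, Head a] @ w, s(a := e, b := - e))"

definition ordered :: "int \<Rightarrow> 'a \<Rightarrow> 'a \<Rightarrow> 'a list" where
  "ordered o' x y = (if o' = 1 then [x, y] else [y, x])"

text \<open>
  \<open>R3_arcs s T M B\<close>: the lists \<open>T\<close>, \<open>M\<close>, \<open>B\<close> are the endpoints on the top, middle and bottom arcs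
  of an admissible configuration. The two rules of \<open>R3\<close> are the two possible cyclic orders of
  the three arcs.
\<close>

inductive R3_arcs :: "(nat \<Rightarrow> int) \<Rightarrow> nat endpoint list \<Rightarrow> nat endpoint list \<Rightarrow> nat endpoint list \<Rightarrow> bool"
  for s where
  "\<lbrakk>P = 1 \<or> P = -1; oM = P * s tm; oB = P * s tb; oT = P * s tm * s tb * s mb\<rbrakk> \<Longrightarrow>
   R3_arcs s (ordered oT (Tail tm) (Tail tb))
             (ordered oM (Head tm) (Tail mb))
             (ordered oB (Head tb) (Head mb))"

inductive R3 :: "diagram \<Rightarrow> diagram \<Rightarrow> bool" where
  "R3_arcs s T M B \<Longrightarrow> R3 (T @ u @ M @ v @ B @ w, s) (rev T @ u @ rev M @ v @ rev B @ w, s)"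
| "R3_arcs s T M B \<Longrightarrow> R3 (T @ u @ B @ v @ M @ w, s) (rev T @ u @ rev B @ v @ rev M @ w, s)"

definition reidemeister :: "diagram \<Rightarrow> diagram \<Rightarrow> bool" where
  "reidemeister D D' \<longleftrightarrow> D \<in> gauss_diagrams \<and> D' \<in> gauss_diagrams \<and>
     symclp (\<lambda>D D'. gauss_iso D D' \<or> R1 D D' \<or> R2 D D' \<or> R3 D D') D D'"

definition isotopy :: "diagram rel" where
  "isotopy = {(D, D'). D \<in> gauss_diagrams \<and> D' \<in> gauss_diagrams \<and> reidemeister\<^sup>*\<^sup>* D D'}"

type_synonym virtual_knot = "diagram set"

definition virtual_knots :: "virtual_knot set" where
  "virtual_knots = gauss_diagrams // isotopy"

primrec reverse_end :: "'c endpoint \<Rightarrow> 'c endpoint" where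
  "reverse_end (Tail c) = Head c"
| "reverse_end (Head c) = Tail c"

inductive flip :: "diagram \<Rightarrow> diagram \<Rightarrow> bool" where
  "c \<in> chords w \<Longrightarrow>
   flip (w, s) (map (\<lambda>x. if c \<in> set_endpoint x then reverse_end x else x) w, s(c := - s c))"

text \<open>\<open>homotopy n D D'\<close>: some homotopy from \<open>D\<close> to \<open>D'\<close> has exactly \<open>n\<close> flip moves.\<close>

inductive homotopy :: "nat \<Rightarrow> diagram \<Rightarrow> diagram \<Rightarrow> bool" where
  "D \<in> gauss_diagrams \<Longrightarrow> homotopy 0 D D"
| "homotopy n D D' \<Longrightarrow> reidemeister D' D'' \<Longrightarrow> homotopy n D D''"
| "homotopy n D D' \<Longrightarrow> flip D' D'' \<Longrightarrow> homotopy (Suc n) D D''"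

definition homotopic :: "virtual_knot rel" where
  "homotopic = {(K, K'). K \<in> virtual_knots \<and> K' \<in> virtual_knots \<and>
     (\<exists>D\<in>K. \<exists>D'\<in>K'. \<exists>n. homotopy n D D')}"

definition homotopy_classes :: "virtual_knot set set" where
  "homotopy_classes = virtual_knots // homotopic"

text \<open>
  Arcs between consecutive heads are indexed by the position \<open>i\<close> of the head at which they begin;
  the endpoints in the interior of the arc are those met from there before the next head.
\<close>

definition arc_interior :: "'c endpoint list \<Rightarrow> nat \<Rightarrow> 'c endpoint list" where
  "arc_interior w i = takeWhile (\<lambda>x. \<not> is_head x) (tl (rotate i w))"

definition bridges :: "diagram \<Rightarrow> nat" where
  "bridges D = (case D of (w, s) \<Rightarrow>
     card {i. i < length w \<and> is_head (w ! i) \<and> (\<exists>x\<in>set (arc_interior w i). is_tail x)})"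

definition vb :: "virtual_knot \<Rightarrow> nat" where
  "vb K = (LEAST n. \<exists>D\<in>K. bridges D = n)"

text \<open>Meaningful only for homotopic virtual knots.\<close>

definition rvu :: "virtual_knot \<Rightarrow> virtual_knot \<Rightarrow> nat" where
  "rvu K K' = (LEAST n. \<exists>D\<in>K. \<exists>D'\<in>K'. homotopy n D D')"

end

theory Submission
  imports Defs
begin

text \<open>
  Give a tail of a chord of sign \<open>e\<close> the weight \<open>e\<close> and its head the weight \<open>-e\<close>. A flip exchanges
  the roles of the two endpoints and negates the sign, so it leaves every weight in place. The index
  of a chord is the sum of the weights met strictly between its tail and its head. The total weight of
  the circle is zero and the two ends of a chord cancel, so a flip of a chord negates its own index
  and changes no other one. Reidemeister moves keep the indices of surviving chords; (R1) adds
  a chord of index \<open>0\<close>, and (R2) adds two chords of equal index and opposite sign. Hence for every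
  \<open>\<phi>\<close> with \<open>\<phi> 0 = 0\<close> the sum of \<open>sign * \<phi> index\<close> over the chords is an invariant of the virtual
  knot (\<open>index_sum_isotopy\<close>), and a flip of a chord of sign \<open>e\<close> and index \<open>k\<close> lowers it by
  \<open>e * (\<phi> k + \<phi> (- k))\<close> (\<open>index_sum_flip\<close>). Two kinds of \<open>\<phi>\<close> are used.
  
  For odd \<open>\<phi>\<close> the sum is invariant under homotopy. Taking \<open>\<phi>\<close> to be the difference of
  the indicators of \<open>n\<close> and \<open>-n\<close> gives \<open>flat_writhe n\<close>; these are the coefficients of Turaev's
  \<open>u\<close>-polynomial of the underlying flat knot. For the indicator of the positive integers the sum,
  \<open>positive_writhe\<close>, changes by at most one at each flip, and so bounds \<open>rvu\<close> from below.
  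
  The diagram starting the sequence for \<open>(p, q)\<close> consists of \<open>p\<close> parallel and \<open>q\<close> parallel positive chords,
  each of the first kind crossing each of the second; it is drawn with all tails before all heads.
  Its indices are \<open>q\<close> (for \<open>p\<close> chords) and \<open>-p\<close> (for \<open>q\<close> chords), so its \<open>u\<close>-polynomial is
  \<open>p * t ^ q - q * t ^ p\<close>. For \<open>p \<noteq> q\<close> this determines the pair \<open>(p, q)\<close>, and it is not zero, which
  excludes diagrams without chords and hence bridge number \<open>0\<close>.
  
  A one-bridge circle has two boundaries between tails and heads. Place a pair of chords \<open>x\<close>, \<open>y\<close> of the
  same sign with the tail of \<open>x\<close> and the head of \<open>y\<close> on either side of one boundary, and the tail of \<open>y\<close> and
  the head of \<open>x\<close> on either side of the other. The result has again one bridge. After a flip of \<open>y\<close>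
  the pair can be removed by (R2); so adding the pair costs one flip, and it
  raises \<open>positive_writhe\<close> by one (lemma \<open>clasp\<close>). Repetition gives diagrams \<open>clasped p q j\<close>
  in which \<open>i\<close> and \<open>j\<close> are joined by \<open>|i - j|\<close> flips, while \<open>positive_writhe\<close> shows that fewer do not suffice.
\<close>

section \<open>Chords and Gauss diagrams\<close>

lemma chords_Nil [simp]: "chords [] = {}"
  by (simp add: chords_def)

lemma chords_Cons [simp]: "chords (x # w) = set_endpoint x \<union> chords w"
  by (simp add: chords_def)

lemma chords_append [simp]: "chords (u @ v) = chords u \<union> chords v"
  by (simp add: chords_def)

lemma finite_set_endpoint [simp]: "finite (set_endpoint x)"
  by (cases x) auto

lemma finite_chords [simp]: "finite (chords w)"
  by (simp add: chords_def)

lemma set_subset_chords: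
  "Tail c \<in> set w \<Longrightarrow> c \<in> chords w" "Head c \<in> set w \<Longrightarrow> c \<in> chords w"
  by (force simp: chords_def)+

lemma chords_iff: "c \<in> chords w \<longleftrightarrow> Tail c \<in> set w \<or> Head c \<in> set w"
proof -
  have "c \<in> set_endpoint x \<longleftrightarrow> x = Tail c \<or> x = Head c" for x
    by (cases x) auto
  then show ?thesis by (auto simp: chords_def)
qed

lemma gauss_diagram_ends:
  assumes "(w, s) \<in> gauss_diagrams" "c \<in> chords w"
  shows "Tail c \<in> set w" "Head c \<in> set w"
  using assms by (auto simp: gauss_diagrams_def chords_iff)

lemma set_gauss_diagram:
  assumes "(w, s) \<in> gauss_diagrams"
  shows "set w = Tail ` chords w \<union> Head ` chords w"
proof (intro equalityI subsetI)
  fix x assume "x \<in> set w"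
  then show "x \<in> Tail ` chords w \<union> Head ` chords w"
    using set_subset_chords[of _ w] by (cases x rule: endpoint.exhaust) blast+
qed (use gauss_diagram_ends[OF assms] in auto)

section \<open>The index of a chord\<close>

text \<open>
  The sign convention makes the weight of an endpoint insensitive to flips: a tail of sign \<open>e\<close> becomes
  a head of sign \<open>-e\<close>.
\<close>

definition weight :: "(nat \<Rightarrow> int) \<Rightarrow> nat endpoint \<Rightarrow> int" where
  "weight s x = (case x of Tail c \<Rightarrow> s c | Head c \<Rightarrow> - s c)"

definition weight_sum :: "(nat \<Rightarrow> int) \<Rightarrow> nat endpoint list \<Rightarrow> int" where
  "weight_sum s w = sum_list (map (weight s) w)"

text \<open>
  The weights strictly before an endpoint, counted from the cut point. Moving the cut point shifts
  all heights by one common constant, so only differences of heights are meaningful on the circle.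
\<close>

definition height :: "(nat \<Rightarrow> int) \<Rightarrow> nat endpoint list \<Rightarrow> nat endpoint \<Rightarrow> int" where
  "height s w x = weight_sum s (takeWhile (\<lambda>y. y \<noteq> x) w)"

text \<open>
  The weights met strictly between the tail and the head on the oriented circle. If the tail comes
  first in the word, the difference of heights counts the weight \<open>s c\<close> of the tail too, which the
  last term removes. If the head comes first, the same expression is minus the sum of the weights strictly
  between head and tail, and this agrees with the circular sum because the total weight is zero.
\<close>

definition chord_index :: "(nat \<Rightarrow> int) \<Rightarrow> nat endpoint list \<Rightarrow> nat \<Rightarrow> int" where
  "chord_index s w c = height s w (Head c) - height s w (Tail c) - s c"

definition index_sum :: "(int \<Rightarrow> int) \<Rightarrow> diagram \<Rightarrow> int" where
  "index_sum \<phi> D = (case D of (w, s) \<Rightarrow> \<Sum>c\<in>chords w. s c * \<phi> (chord_index s w c))"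

lemma weight_simps [simp]: "weight s (Tail c) = s c" "weight s (Head c) = - s c"
  by (simp_all add: weight_def)

lemma weight_sum_simps [simp]:
  "weight_sum s [] = 0" "weight_sum s (x # w) = weight s x + weight_sum s w"
  "weight_sum s (u @ v) = weight_sum s u + weight_sum s v" "weight_sum s (rev u) = weight_sum s u"
  by (simp_all add: weight_sum_def rev_map[symmetric])

lemma height_Nil [simp]: "height s [] x = 0"
  by (simp add: height_def)

lemma height_Cons [simp]:
  "height s (y # w) x = (if y = x then 0 else weight s y + height s w x)"
  by (simp add: height_def)

lemma height_append [simp]:
  "height s (u @ v) x = (if x \<in> set u then height s u x else weight_sum s u + height s v x)"
  by (induction u) auto

lemma weight_cong: "(\<And>c. c \<in> set_endpoint x \<Longrightarrow> s c = s' c) \<Longrightarrow> weight s x = weight s' x"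
  by (cases x) auto

lemma weight_sum_cong: "(\<And>c. c \<in> chords w \<Longrightarrow> s c = s' c) \<Longrightarrow> weight_sum s w = weight_sum s' w"
  by (induction w) (auto intro!: weight_cong)

lemma weight_sum_fun_upd [simp]: "c \<notin> chords w \<Longrightarrow> weight_sum (s(c := e)) w = weight_sum s w"
  by (rule weight_sum_cong) auto

lemma height_fun_upd [simp]: "c \<notin> chords w \<Longrightarrow> height (s(c := e)) w x = height s w x"
proof (induction w)
  case (Cons y w)
  then show ?case by (cases y) auto
qed simp

text \<open>
  The two ends of each chord have opposite weights.
\<close>

lemma weight_sum_gauss_diagram:
  assumes "(w, s) \<in> gauss_diagrams"
  shows "weight_sum s w = 0"
proof -
  have d: "distinct w"
    using assms by (simp add: gauss_diagrams_def)
  have "weight_sum s w = sum (weight s) (set w)"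
    using d by (simp add: weight_sum_def sum_list_distinct_conv_sum_set)
  also have "\<dots> = sum (weight s) (Tail ` chords w) + sum (weight s) (Head ` chords w)"
    by (subst set_gauss_diagram[OF assms], rule sum.union_disjoint) auto
  also have "\<dots> = 0"
    by (simp add: sum.reindex inj_on_def sum_negf)
  finally show ?thesis .
qed

section \<open>Invariance under isotopy\<close>

lemma chords_rename: "chords (map (map_endpoint f) w) = f ` chords w"
  by (auto simp: chords_def endpoint.set_map)

lemma height_rename:
  assumes "inj_on f (chords w \<union> set_endpoint x)" "\<And>c. c \<in> chords w \<Longrightarrow> s' (f c) = s c"
  shows "height s' (map (map_endpoint f) w) (map_endpoint f x) = height s w x"
  using assms
proof (induction w)
  case (Cons y w)
  have "map_endpoint f y = map_endpoint f x \<longleftrightarrow> y = x"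
    using Cons.prems(1) by (cases x; cases y) (auto simp: inj_on_def)
  moreover have "weight s' (map_endpoint f y) = weight s y"
    using Cons.prems(2) by (cases y) auto
  moreover have "height s' (map (map_endpoint f) w) (map_endpoint f x) = height s w x"
    using Cons by (auto intro: inj_on_subset)
  ultimately show ?case by simp
qed simp

lemma index_sum_rename:
  assumes "inj_on f (chords w)" "\<And>c. c \<in> chords w \<Longrightarrow> s' (f c) = s c"
  shows "index_sum \<phi> (map (map_endpoint f) w, s') = index_sum \<phi> (w, s)"
proof -
  have "chord_index s' (map (map_endpoint f) w) (f c) = chord_index s w c" if "c \<in> chords w" for c
  proof -
    have "inj_on f (chords w \<union> {c})" using assms that by (simp add: insert_absorb)
    then show ?thesis
      using height_rename[of f w "Tail c" s' s] height_rename[of f w "Head c" s' s] assms that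
      by (simp add: chord_index_def)
  qed
  then show ?thesis
    using assms by (simp add: index_sum_def chords_rename sum.reindex)
qed

text \<open>
  Rotation shifts all heights by the same amount (\<open>shift\<close> in the proof): an endpoint in the first block
  gains the total of the second block, and one in the second loses the total of the
  first, which is the same since the two totals cancel.
\<close>

lemma index_sum_rotate:
  assumes "(w, s) \<in> gauss_diagrams"
  shows "index_sum \<phi> (rotate k w, s) = index_sum \<phi> (w, s)"
proof -
  define u v where "u = take (k mod length w) w" and "v = drop (k mod length w) w"
  have w: "w = u @ v" and r: "rotate k w = v @ u"
    by (simp_all add: u_def v_def rotate_drop_take)
  have 0: "weight_sum s u + weight_sum s v = 0"
    using weight_sum_gauss_diagram[OF assms] w by simp
  have "set u \<inter> set v = {}" using assms w by (auto simp: gauss_diagrams_def)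
  then have shift: "height s (v @ u) x = height s (u @ v) x + weight_sum s v" if "x \<in> set w" for x
    using 0 that w by auto
  have "chord_index s (v @ u) c = chord_index s (u @ v) c" if "c \<in> chords w" for c
    using shift gauss_diagram_ends[OF assms that] by (simp add: chord_index_def del: height_append)
  then show ?thesis
    unfolding r unfolding w by (simp add: w index_sum_def Un_commute)
qed

lemma gauss_diagram_rename:
  assumes "(w, s) \<in> gauss_diagrams" "inj_on f (chords w)" "\<And>c. c \<in> chords w \<Longrightarrow> s' (f c) = s c"
  shows "(map (map_endpoint f) w, s') \<in> gauss_diagrams"
proof -
  have "inj_on (map_endpoint f) (set w)"
  proof (rule inj_onI)
    fix x y assume "x \<in> set w" "y \<in> set w" "map_endpoint f x = map_endpoint f y"
    then show "x = y"
      using assms(2) by (cases x rule: endpoint.exhaust; cases y rule: endpoint.exhaust)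
        (auto simp: chords_iff inj_on_def)
  qed
  moreover have "map_endpoint f ` set w = Tail ` f ` chords w \<union> Head ` f ` chords w"
    by (simp add: set_gauss_diagram[OF assms(1)] image_Un image_image)
  ultimately show ?thesis
    using assms by (auto simp: gauss_diagrams_def distinct_map chords_rename)
qed

lemma index_sum_gauss_iso:
  assumes "gauss_iso D D'" "D \<in> gauss_diagrams"
  shows "index_sum \<phi> D' = index_sum \<phi> D"
proof -
  obtain w s w' s' where D: "D = (w, s)" "D' = (w', s')" by (cases D; cases D')
  with assms obtain k f where f: "inj_on f (chords w)" "w' = rotate k (map (map_endpoint f) w)"
      "\<And>c. c \<in> chords w \<Longrightarrow> s' (f c) = s c"
    by (auto simp: gauss_iso_def)
  show ?thesis
    using index_sum_rotate[OF gauss_diagram_rename] index_sum_rename f assms D by simp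
qed

text \<open>
  The new chord encloses nothing, so its index is \<open>0\<close>; its two adjacent ends cancel in every other height.
\<close>

lemma index_sum_R1:
  assumes "R1 D D'" "D' \<in> gauss_diagrams" "\<phi> 0 = 0"
  shows "index_sum \<phi> D' = index_sum \<phi> D"
  using assms
proof cases
  case (1 u v s c e)
  have c: "c \<notin> chords u" "c \<notin> chords v"
    using assms(2) 1 by (auto simp: gauss_diagrams_def chords_iff)
  have "chord_index (s(c := e)) (u @ [Tail c, Head c] @ v) d = chord_index s (u @ v) d"
    if "d \<noteq> c" for d
    using c that by (simp add: chord_index_def)
  moreover have "chord_index (s(c := e)) (u @ [Tail c, Head c] @ v) c = 0"
    using c by (simp add: chord_index_def chords_iff)
  ultimately show ?thesis
    using 1 c assms(3) by (auto simp: index_sum_def intro!: sum.cong)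
next
  case (2 u v s c e)
  have c: "c \<notin> chords u" "c \<notin> chords v"
    using assms(2) 2 by (auto simp: gauss_diagrams_def chords_iff)
  have "chord_index (s(c := e)) (u @ [Head c, Tail c] @ v) d = chord_index s (u @ v) d"
    if "d \<noteq> c" for d
    using c that by (simp add: chord_index_def)
  moreover have "chord_index (s(c := e)) (u @ [Head c, Tail c] @ v) c = 0"
    using c by (simp add: chord_index_def chords_iff)
  ultimately show ?thesis
    using 2 c assms(3) by (auto simp: index_sum_def intro!: sum.cong)
qed

lemma index_sum_insert_pair:
  assumes "chords w' = insert a (insert b (chords w))" "a \<noteq> b" "a \<notin> chords w" "b \<notin> chords w"
    and "s' a = - s' b" "chord_index s' w' a = chord_index s' w' b"
    and "\<And>d. d \<in> chords w \<Longrightarrow> s' d = s d \<and> chord_index s' w' d = chord_index s w d"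
  shows "index_sum \<phi> (w', s') = index_sum \<phi> (w, s)"
  using assms by (simp add: index_sum_def)

text \<open>
  Adjacent tails, like adjacent heads, of opposite sign have cancelling weights, so the old indices are
  kept. If the new chords do not cross, one of them encloses both ends or neither end of the other.
  If they cross, each encloses one end of the other, and these two ends have the same weight because the
  signs are opposite. In either case their indices agree, and their contributions cancel.
\<close>

lemma index_sum_R2:
  assumes "R2 D D'" "D' \<in> gauss_diagrams"
  shows "index_sum \<phi> D' = index_sum \<phi> D"
  using assms
proof cases
  case (1 u v w s a b e)
  have c: "a \<noteq> b" "a \<notin> chords u" "a \<notin> chords v" "a \<notin> chords w"
      "b \<notin> chords u" "b \<notin> chords v" "b \<notin> chords w"
    using assms(2) 1 by (auto simp: gauss_diagrams_def chords_iff)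
  show ?thesis unfolding 1
    by (rule index_sum_insert_pair[where a = a and b = b])
      (use c in \<open>auto simp: chord_index_def chords_iff\<close>)
next
  case (2 u v w s a b e)
  have c: "a \<noteq> b" "a \<notin> chords u" "a \<notin> chords v" "a \<notin> chords w"
      "b \<notin> chords u" "b \<notin> chords v" "b \<notin> chords w"
    using assms(2) 2 by (auto simp: gauss_diagrams_def chords_iff)
  show ?thesis unfolding 2
    by (rule index_sum_insert_pair[where a = a and b = b])
      (use c in \<open>auto simp: chord_index_def chords_iff\<close>)
qed

lemma set_ordered [simp]: "set (ordered i x y) = {x, y}"
  by (auto simp: ordered_def)

lemma weight_sum_ordered [simp]: "weight_sum s (ordered i x y) = weight s x + weight s y"
  by (simp add: ordered_def)

lemma chords_rev [simp]: "chords (rev w) = chords w"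
  by (simp add: chords_def)

text \<open>
  On a single arc, an exchange puts the weight of one endpoint in front of the other and takes the
  weight of the other from in front of the first; \<open>i\<close> tells which is which.
\<close>

lemma height_rev_ordered:
  assumes "i = 1 \<or> i = -1" "x \<noteq> y"
  shows "height s (rev (ordered i x y)) x = height s (ordered i x y) x + i * weight s y"
    and "height s (rev (ordered i x y)) y = height s (ordered i x y) y - i * weight s x"
  using assms by (auto simp: ordered_def)

text \<open>
  Each exchange on an arc changes the heights of the two endpoints on that arc only. The index of each
  of the three chords is therefore changed by one term from each of the two arcs it meets, and the
  admissibility condition on the configuration says exactly that these two terms cancel.
\<close>

lemma index_sum_R3:
  assumes "R3 D D'" "D \<in> gauss_diagrams"
  shows "index_sum \<phi> D' = index_sum \<phi> D"
proof -
  \<comment> \<open>One computation covers both cyclic orders of the arcs.\<close>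
  have main: "index_sum \<phi> (w', s) = index_sum \<phi> (w, s)"
    if arcs: "R3_arcs s T M B" and w: "(w, s) \<in> gauss_diagrams"
      and ww': "w = T @ u @ M @ v @ B @ z \<and> w' = rev T @ u @ rev M @ v @ rev B @ z \<or>
        w = T @ u @ B @ v @ M @ z \<and> w' = rev T @ u @ rev B @ v @ rev M @ z"
    for w w' s T M B u v z
  proof -
    have other: "height s w' x = height s w x" if "x \<notin> set T \<union> set M \<union> set B" for x
      using ww' that by auto
    have "distinct w" using w by (simp add: gauss_diagrams_def)
    then have arc: "height s w' x - height s w x = height s (rev A) x - height s A x"
      if "A \<in> {T, M, B}" "x \<in> set A" for x A
      using ww' that by auto
    have "chord_index s w' c = chord_index s w c" if "c \<in> chords w" for c
      using arcs
    proof cases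
      case (1 P oM tm oB tb oT mb)
      have "set T \<inter> set M = {}" "set T \<inter> set B = {}" "set M \<inter> set B = {}"
          "distinct T" "distinct M" "distinct B"
        using \<open>distinct w\<close> ww' by auto
      then have ne: "tm \<noteq> tb" "tb \<noteq> mb" "tm \<noteq> mb"
        using 1 by (auto simp: ordered_def split: if_splits)
      have "tm \<in> chords w" "tb \<in> chords w" "mb \<in> chords w"
        using ww' 1 by (auto simp: chords_iff)
      then have sg: "s tm = 1 \<or> s tm = -1" "s tb = 1 \<or> s tb = -1" "s mb = 1 \<or> s mb = -1"
        using w by (auto simp: gauss_diagrams_def)
      have o: "oT = 1 \<or> oT = -1" "oM = 1 \<or> oM = -1" "oB = 1 \<or> oB = -1"
        using sg 1 by auto
      have hT: "height s w' (Tail tm) = height s w (Tail tm) + oT * s tb"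
          "height s w' (Tail tb) = height s w (Tail tb) - oT * s tm"
        using arc[of T "Tail tm"] arc[of T "Tail tb"] height_rev_ordered[OF o(1), of "Tail tm" "Tail tb" s] ne
        by (auto simp: 1(1))
      have hM: "height s w' (Head tm) = height s w (Head tm) + oM * s mb"
          "height s w' (Tail mb) = height s w (Tail mb) + oM * s tm"
        using arc[of M "Head tm"] arc[of M "Tail mb"] height_rev_ordered[OF o(2), of "Head tm" "Tail mb" s] ne
        by (auto simp: 1(2))
      have hB: "height s w' (Head tb) = height s w (Head tb) - oB * s mb"
          "height s w' (Head mb) = height s w (Head mb) + oB * s tb"
        using arc[of B "Head tb"] arc[of B "Head mb"] height_rev_ordered[OF o(3), of "Head tb" "Head mb" s] ne
        by (auto simp: 1(3))
      \<comment> \<open>One equation for each of \<open>tm\<close>, \<open>tb\<close>, \<open>mb\<close>: the heights of its two ends change alike. As signs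
        square to one, both sides are \<open>P * s tm * s mb\<close>, \<open>P * s tb * s mb\<close> and \<open>P\<close>.\<close>
      have "oT * s tb = oM * s mb" "oT * s tm = oB * s mb" "oM * s tm = oB * s tb"
        using sg 1(5-7) by auto
      then have "chord_index s w' c = chord_index s w c" if "c \<in> {tm, tb, mb}"
        using that hT hM hB by (auto simp: chord_index_def)
      moreover have "chord_index s w' c = chord_index s w c" if "c \<notin> {tm, tb, mb}"
        using that other[of "Tail c"] other[of "Head c"] by (simp add: 1(1-3) chord_index_def)
      ultimately show ?thesis by blast
    qed
    moreover have "chords w' = chords w" using ww' by auto
    ultimately show ?thesis by (simp add: index_sum_def)
  qed
  show ?thesis
    using assms(1)
  proof cases
    case (1 s T M B u v w)
    then show ?thesis using main[OF 1(3)] assms(2) by blast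
  next
    case (2 s T M B u v w)
    then show ?thesis using main[OF 2(3)] assms(2) by blast
  qed
qed

lemma index_sum_reidemeister:
  assumes "reidemeister D D'" "\<phi> 0 = 0"
  shows "index_sum \<phi> D' = index_sum \<phi> D"
proof -
  have "index_sum \<phi> E' = index_sum \<phi> E"
    if "gauss_iso E E' \<or> R1 E E' \<or> R2 E E' \<or> R3 E E'" "E \<in> gauss_diagrams" "E' \<in> gauss_diagrams"
    for E E'
    using that assms(2) index_sum_gauss_iso index_sum_R1 index_sum_R2 index_sum_R3 by metis
  with assms(1) show ?thesis
    unfolding reidemeister_def symclp_def by metis
qed

lemma index_sum_isotopy:
  assumes "(D, D') \<in> isotopy" "\<phi> 0 = 0"
  shows "index_sum \<phi> D' = index_sum \<phi> D"
proof -
  have "reidemeister\<^sup>*\<^sup>* D D'" using assms(1) by (simp add: isotopy_def)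
  then show ?thesis
    by induction (use index_sum_reidemeister assms(2) in auto)
qed

section \<open>The effect of a flip\<close>

definition flip_word :: "nat \<Rightarrow> nat endpoint list \<Rightarrow> nat endpoint list" where
  "flip_word c w = map (\<lambda>x. if c \<in> set_endpoint x then reverse_end x else x) w"

lemma flip_word_simps [simp]:
  "flip_word c [] = []"
  "flip_word c (x # w) = (if c \<in> set_endpoint x then reverse_end x else x) # flip_word c w"
  "flip_word c (u @ v) = flip_word c u @ flip_word c v"
  by (simp_all add: flip_word_def)

lemma flip_word_id: "c \<notin> chords w \<Longrightarrow> flip_word c w = w"
  by (induction w) auto

lemma set_endpoint_reverse_end [simp]: "set_endpoint (reverse_end x) = set_endpoint x"
  by (cases x) auto

lemma reverse_end_reverse_end [simp]: "reverse_end (reverse_end x) = x"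
  by (cases x) auto

lemma flip_word_flip_word [simp]: "flip_word c (flip_word c w) = w"
  by (induction w) auto

lemma chords_flip_word [simp]: "chords (flip_word c w) = chords w"
  by (induction w) auto

lemma flip_iff:
  "flip (w, s) D' \<longleftrightarrow> (\<exists>c\<in>chords w. D' = (flip_word c w, s(c := - s c)))"
  by (auto simp: flip.simps flip_word_def)

lemma flip_sym: "flip D D' \<Longrightarrow> flip D' D"
  by (cases D; cases D') (auto simp: flip_iff)

lemma set_flip_word:
  "(Tail d \<in> set (flip_word c w) \<longleftrightarrow> (if d = c then Head d \<in> set w else Tail d \<in> set w)) \<and>
   (Head d \<in> set (flip_word c w) \<longleftrightarrow> (if d = c then Tail d \<in> set w else Head d \<in> set w))"
proof (induction w)
  case (Cons x w)
  then show ?case by (cases x) auto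
qed simp

lemma distinct_flip_word [simp]: "distinct (flip_word c w) = distinct w"
proof -
  have "distinct (flip_word c w)" if "distinct w" for w
    using that
  proof (induction w)
    case (Cons x w)
    then show ?case by (cases x) (auto simp: set_flip_word)
  qed simp
  from this[of w] this[of "flip_word c w"] show ?thesis by auto
qed

lemma flip_gauss_diagram:
  assumes "flip D D'" "D \<in> gauss_diagrams"
  shows "D' \<in> gauss_diagrams"
proof -
  obtain w s where D: "D = (w, s)" by (cases D)
  with assms(1) obtain c where c: "c \<in> chords w" "D' = (flip_word c w, s(c := - s c))"
    by (auto simp: flip_iff)
  have "s d = 1 \<or> s d = -1" if "d \<in> chords w" for d
    using assms(2) D that by (auto simp: gauss_diagrams_def)
  then show ?thesis
    using assms(2) c D by (simp add: gauss_diagrams_def set_flip_word) fastforce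
qed

text \<open>
  Weights stay in place under a flip, so every position keeps its height; the flipped chord
  exchanges the names of its two positions.
\<close>

lemma height_flip_word_self:
  "height (s(c := - s c)) (flip_word c w) (Tail c) = height s w (Head c) \<and>
   height (s(c := - s c)) (flip_word c w) (Head c) = height s w (Tail c)"
proof (induction w)
  case (Cons x w)
  then show ?case by (cases x) auto
qed simp

lemma height_flip_word_other:
  assumes "d \<noteq> c"
  shows "height (s(c := - s c)) (flip_word c w) (Tail d) = height s w (Tail d) \<and>
    height (s(c := - s c)) (flip_word c w) (Head d) = height s w (Head d)"
proof (induction w)
  case (Cons x w)
  then show ?case using assms by (cases x) auto
qed simp

text \<open>
  The flipped chord exchanges the heights of its ends and negates its sign, so its index is negated;
  all other chords keep sign and index.
\<close>

lemma index_sum_flip: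
  assumes "c \<in> chords w"
  shows "index_sum \<phi> (flip_word c w, s(c := - s c)) = index_sum \<phi> (w, s)
    - s c * (\<phi> (chord_index s w c) + \<phi> (- chord_index s w c))"
proof -
  let ?s = "s(c := - s c)" and ?w = "flip_word c w"
  have d: "chord_index ?s ?w d = chord_index s w d" if "d \<noteq> c" for d
    using that by (simp add: chord_index_def height_flip_word_other)
  have c: "chord_index ?s ?w c = - chord_index s w c"
    by (simp add: chord_index_def height_flip_word_self)
  show ?thesis
    using assms d c by (simp add: index_sum_def sum.remove[of _ c] algebra_simps)
qed

lemma homotopy_gauss_diagram: "homotopy n D D' \<Longrightarrow> D \<in> gauss_diagrams \<and> D' \<in> gauss_diagrams"
  by (induction rule: homotopy.induct) (auto simp: reidemeister_def intro: flip_gauss_diagram)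

lemma homotopy_trans:
  assumes "homotopy m D D'" "homotopy n D' D''"
  shows "homotopy (m + n) D D''"
  using assms(2,1) by (induction rule: homotopy.induct) (auto intro: homotopy.intros)

lemma reidemeister_sym: "reidemeister D D' \<Longrightarrow> reidemeister D' D"
  by (auto simp: reidemeister_def symclp_def)

lemma homotopy_sym:
  assumes "homotopy n D D'"
  shows "homotopy n D' D"
  using assms
proof induction
  case (2 n D D' D'')
  then have "homotopy 0 D'' D'"
    using reidemeister_sym homotopy.intros(1,2) by (metis reidemeister_def)
  then show ?case using homotopy_trans 2 by fastforce
next
  case (3 n D D' D'')
  then have "homotopy 1 D'' D'"
    using flip_sym homotopy.intros(1,3) flip_gauss_diagram homotopy_gauss_diagram by (metis One_nat_def)
  then show ?case using homotopy_trans 3 by fastforce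
qed (auto intro: homotopy.intros)

text \<open>
  For odd \<open>\<phi>\<close> the two terms in the change under a flip cancel.
\<close>

lemma index_sum_homotopy:
  assumes "homotopy n D D'" "\<And>k. \<phi> (- k) = - \<phi> k"
  shows "index_sum \<phi> D' = index_sum \<phi> D"
  using assms(1)
proof induction
  case (2 n D D' D'')
  have "\<phi> 0 = 0" using assms(2)[of 0] by simp
  then show ?case using index_sum_reidemeister 2 by metis
next
  case (3 n D D' D'')
  obtain w s where "D' = (w, s)" by (cases D')
  with 3 show ?case by (auto simp: flip_iff index_sum_flip assms(2))
qed simp

definition positive_writhe :: "diagram \<Rightarrow> int" where
  "positive_writhe = index_sum (\<lambda>k. if k > 0 then 1 else 0)"

text \<open>
  At most one of \<open>k\<close> and \<open>-k\<close> is positive, so a flip changes the value by at most one.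
\<close>

lemma positive_writhe_homotopy:
  assumes "homotopy n D D'"
  shows "\<bar>positive_writhe D' - positive_writhe D\<bar> \<le> int n"
  using assms
proof induction
  case (2 n D D' D'')
  then show ?case using index_sum_reidemeister[of D' D''] by (simp add: positive_writhe_def)
next
  case (3 n D D' D'')
  obtain w s where D': "D' = (w, s)" by (cases D')
  with 3 obtain c where c: "c \<in> chords w" "D'' = (flip_word c w, s(c := - s c))"
    by (auto simp: flip_iff)
  have "s c = 1 \<or> s c = -1"
    using homotopy_gauss_diagram[OF 3(1)] c D' by (auto simp: gauss_diagrams_def)
  then have "\<bar>positive_writhe D'' - positive_writhe D'\<bar> \<le> 1"
    using c D' by (auto simp: positive_writhe_def index_sum_flip)
  with 3 show ?case by auto
qed simp

section \<open>One-bridge diagrams\<close>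

text \<open>
  All crossings are positive, so that an added pair of chords always raises \<open>positive_writhe\<close>; contributions
  of successive pairs cannot cancel.
\<close>

definition one_bridge :: "nat list \<Rightarrow> nat list \<Rightarrow> diagram" where
  "one_bridge ts hs = (map Tail ts @ map Head hs, \<lambda>_. 1)"

lemma chords_map_Tail [simp]: "chords (map Tail ts) = set ts"
  and chords_map_Head [simp]: "chords (map Head ts) = set ts"
  by (simp_all add: chords_def)

lemma one_bridge_gauss_diagram:
  assumes "distinct ts" "distinct hs" "set ts = set hs"
  shows "one_bridge ts hs \<in> gauss_diagrams"
  using assms by (auto simp: one_bridge_def gauss_diagrams_def distinct_map inj_on_def)

text \<open>
  Only the last head of the word, where the circle closes up, can be followed by a tail.
\<close>

lemma bridges_one_bridge: "bridges (one_bridge ts hs) \<le> 1"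
proof -
  let ?w = "map Tail ts @ map Head hs" and ?n = "length ts + length hs"
  have "{i. i < length ?w \<and> is_head (?w ! i) \<and> (\<exists>x\<in>set (arc_interior ?w i). is_tail x)} \<subseteq> {?n - 1}"
  proof
    fix i
    assume "i \<in> {i. i < length ?w \<and> is_head (?w ! i) \<and> (\<exists>x\<in>set (arc_interior ?w i). is_tail x)}"
    then have i: "i < ?n" "is_head (?w ! i)" "arc_interior ?w i \<noteq> []" by auto
    have "i \<ge> length ts" using i by (auto simp: nth_append split: if_splits)
    show "i \<in> {?n - 1}"
    proof (rule ccontr)
      assume "i \<notin> {?n - 1}"
      then have "Suc i < ?n" using i by simp
      then have "tl (rotate i ?w) = drop (Suc i) ?w @ take i ?w"
        by (simp add: rotate_drop_take drop_Suc tl_drop del: drop_append take_append)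
      also have "\<dots> = Head (hs ! (Suc i - length ts)) # drop (Suc (Suc i)) ?w @ take i ?w"
        using \<open>Suc i < ?n\<close> \<open>i \<ge> length ts\<close>
        by (subst Cons_nth_drop_Suc[symmetric]) (auto simp: nth_append simp del: drop_append take_append)
      finally show False using i(3) by (simp add: arc_interior_def)
    qed
  qed
  then show ?thesis
    unfolding bridges_def one_bridge_def using card_mono[of "{?n - 1}"] by force
qed

text \<open>
  Somewhere on the circle a head is followed immediately by a tail: otherwise, starting from a head and walking
  around the circle, one would meet heads only.
\<close>

lemma bridges_pos:
  assumes "(w, s) \<in> gauss_diagrams" "w \<noteq> []"
  shows "bridges (w, s) > 0"
proof -
  let ?n = "length w"
  obtain c where "c \<in> chords w"
    using assms(2) by (cases w; cases "hd w") auto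
  then obtain i0 j0 where i0: "i0 < ?n" "w ! i0 = Tail c" and j0: "j0 < ?n" "w ! j0 = Head c"
    using gauss_diagram_ends[OF assms(1)] by (metis in_set_conv_nth)
  have "\<exists>i<?n. is_head (w ! i) \<and> is_tail (w ! (Suc i mod ?n))"
  proof (rule ccontr)
    assume "\<not> ?thesis"
    then have step: "is_head (w ! (Suc i mod ?n))" if "i < ?n" "is_head (w ! i)" for i
      using that by (auto simp: endpoint.distinct_disc endpoint.exhaust_disc) (meson endpoint.exhaust_disc)
    have "is_head (w ! ((j0 + m) mod ?n))" for m
    proof (induction m)
      case (Suc m)
      then show ?case
        using step[of "(j0 + m) mod ?n"] assms(2) by (simp add: mod_simps)
    qed (use j0 in simp)
    from this[of "?n - j0 + i0"] show False
      using i0 j0 by simp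
  qed
  then obtain i where i: "i < ?n" "is_head (w ! i)" "is_tail (w ! (Suc i mod ?n))" by blast
  have n: "?n > 1"
    using i by (cases "?n = 1") (auto simp: is_tail_def)
  have "rotate i w ! 1 = w ! (Suc i mod ?n)"
    using n by (simp add: nth_rotate)
  moreover obtain h x r where "rotate i w = h # x # r"
    using n by (cases "rotate i w" rule: remdups_adj.cases) (auto dest: arg_cong[where f = length])
  ultimately have "tl (rotate i w) = x # r" "is_tail x"
    using i(3) by simp_all
  then have "\<exists>x\<in>set (arc_interior w i). is_tail x"
    by (auto simp: arc_interior_def is_tail_def)
  with i have "{i. i < ?n \<and> is_head (w ! i) \<and> (\<exists>x\<in>set (arc_interior w i). is_tail x)} \<noteq> {}"
    by blast
  then show ?thesis
    by (auto simp: bridges_def card_gt_0_iff)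
qed

lemma weight_sum_tails [simp]: "weight_sum (\<lambda>_. 1) (map Tail ts) = int (length ts)"
  by (induction ts) auto

lemma weight_sum_heads [simp]: "weight_sum (\<lambda>_. 1) (map Head ts) = - int (length ts)"
  by (induction ts) auto

text \<open>
  The common step of the construction. In the larger diagram flip \<open>y\<close>: its ends change places, so that
  the tails of \<open>x\<close> and \<open>y\<close> become adjacent, their heads become adjacent across the cut point, and their
  signs become opposite. Up to a rotation of the word this is the smaller diagram after (R2).
  In the larger diagram the index of \<open>y\<close> is positive, since between its tail and its head lie only
  tails, all of weight \<open>1\<close>; therefore the flip changes \<open>positive_writhe\<close> by exactly one.
\<close>

lemma clasp:
  assumes "distinct ts" "distinct hs" "set ts = set hs" "x \<notin> set ts" "y \<notin> set ts" "x \<noteq> y"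
  shows homotopy_clasp: "homotopy 1 (one_bridge ts hs) (one_bridge (y # ts @ [x]) (y # hs @ [x]))"
      (is "homotopy 1 ?D ?D'")
    and positive_writhe_clasp:
      "positive_writhe (one_bridge (y # ts @ [x]) (y # hs @ [x])) = positive_writhe (one_bridge ts hs) + 1"
proof -
  let ?s = "(\<lambda>_. 1 :: int)(x := 1, y := -1)"
  let ?u = "map Tail ts @ [Tail x, Tail y] @ map Head hs @ [Head x]"
  have D: "?D \<in> gauss_diagrams" and D': "?D' \<in> gauss_diagrams"
    using assms by (simp_all add: one_bridge_gauss_diagram)
  have y: "y \<in> chords (fst ?D')" by (simp add: one_bridge_def)
  have "flip_word y (fst ?D') = Head y # ?u"
    using assms by (simp add: one_bridge_def flip_word_id)
  moreover have "(\<lambda>_. 1)(y := - 1) = ?s" by auto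
  ultimately have flip: "(flip_word y (fst ?D'), (snd ?D')(y := - snd ?D' y)) = (Head y # ?u, ?s)"
    by (simp add: one_bridge_def)
  then have f: "flip ?D' (Head y # ?u, ?s)"
    using y flip_iff[of "fst ?D'" "snd ?D'"] unfolding prod.collapse by metis
  have E': "(Head y # ?u, ?s) \<in> gauss_diagrams"
    using flip_gauss_diagram[OF f D'] .
  have E: "(?u @ [Head y], ?s) \<in> gauss_diagrams"
    using E' by (auto simp: gauss_diagrams_def)
  have "R2 ?D (?u @ [Head y], ?s)"
    using R2.intros(1)[of "map Tail ts" "map Head hs" "[]" "\<lambda>_. 1" x y 1]
    by (simp add: one_bridge_def)
  then have r: "reidemeister ?D (?u @ [Head y], ?s)"
    using D E by (simp add: reidemeister_def symclp_def)
  have "gauss_iso (Head y # ?u, ?s) (?u @ [Head y], ?s)"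
    unfolding gauss_iso_def prod.case
    by (rule exI[of _ 1], rule exI[of _ id]) (simp add: endpoint.map_id0)
  then have i: "reidemeister (?u @ [Head y], ?s) (Head y # ?u, ?s)"
    using E E' by (simp add: reidemeister_def symclp_def)
  show "homotopy 1 ?D ?D'"
    using homotopy.intros(3)[OF homotopy.intros(2)[OF homotopy.intros(2)[OF
      homotopy.intros(1)[OF D] r] i] flip_sym[OF f]]
    by simp
  \<comment> \<open>One for each tail in \<open>ts\<close> and one for the tail of \<open>x\<close>.\<close>
  have "chord_index (snd ?D') (fst ?D') y = int (length ts) + 1"
    using assms(4-6) by (auto simp: one_bridge_def chord_index_def)
  then have "positive_writhe (Head y # ?u, ?s) = positive_writhe ?D' - 1"
    using index_sum_flip[OF y, of _ "snd ?D'"] unfolding flip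
    by (simp add: positive_writhe_def one_bridge_def)
  moreover have "positive_writhe (Head y # ?u, ?s) = positive_writhe ?D"
    using index_sum_reidemeister[OF r] index_sum_reidemeister[OF i] by (simp add: positive_writhe_def)
  ultimately show "positive_writhe ?D' = positive_writhe ?D + 1" by simp
qed

section \<open>The family\<close>

text \<open>
  The chords below \<open>p\<close> and those from \<open>p\<close> to \<open>p + q - 1\<close> form the two parallel families: reversing the
  order of the heads within a family keeps its members from crossing each other. The pair added at
  step \<open>j\<close> gets the next two unused names.
\<close>

primrec tails :: "nat \<Rightarrow> nat \<Rightarrow> nat \<Rightarrow> nat list" where
  "tails p q 0 = [0..<p + q]"
| "tails p q (Suc j) = (p + q + 2 * j + 1) # tails p q j @ [p + q + 2 * j]"

primrec heads :: "nat \<Rightarrow> nat \<Rightarrow> nat \<Rightarrow> nat list" where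
  "heads p q 0 = rev [0..<p] @ rev [p..<p + q]"
| "heads p q (Suc j) = (p + q + 2 * j + 1) # heads p q j @ [p + q + 2 * j]"

definition clasped :: "nat \<Rightarrow> nat \<Rightarrow> nat \<Rightarrow> diagram" where
  "clasped p q j = one_bridge (tails p q j) (heads p q j)"

lemma set_tails: "set (tails p q j) = {0..<p + q + 2 * j}"
  and set_heads: "set (heads p q j) = {0..<p + q + 2 * j}"
  by (induction j) auto

lemma distinct_tails: "distinct (tails p q j)"
  by (induction j) (auto simp: set_tails)

lemma distinct_heads: "distinct (heads p q j)"
  by (induction j) (auto simp: set_heads)

lemma clasped_gauss_diagram: "clasped p q j \<in> gauss_diagrams"
  unfolding clasped_def
  by (intro one_bridge_gauss_diagram) (simp_all add: distinct_tails distinct_heads set_tails set_heads)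

lemma homotopy_clasped_Suc: "homotopy 1 (clasped p q j) (clasped p q (Suc j))"
  and positive_writhe_clasped_Suc:
    "positive_writhe (clasped p q (Suc j)) = positive_writhe (clasped p q j) + 1"
  unfolding clasped_def tails.simps heads.simps
  by (intro clasp; simp add: distinct_tails distinct_heads set_tails set_heads)+

lemma homotopy_clasped: "homotopy k (clasped p q j) (clasped p q (j + k))"
proof (induction k)
  case 0
  then show ?case using clasped_gauss_diagram homotopy.intros(1) by simp
next
  case (Suc k)
  then show ?case
    using homotopy_trans[OF _ homotopy_clasped_Suc[of p q "j + k"]] by fastforce
qed

lemma positive_writhe_clasped:
  "positive_writhe (clasped p q j) = positive_writhe (clasped p q 0) + int j"
  by (induction j) (simp_all add: positive_writhe_clasped_Suc)

text \<open>
  A chord of the first family crosses the \<open>q\<close> chords of the second in one direction, and a chord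
  of the second crosses the \<open>p\<close> chords of the first in the other; all the other weights between
  its ends cancel.
\<close>

lemma index_sum_clasped_0:
  "index_sum \<phi> (clasped p q 0) = int p * \<phi> (int q) + int q * \<phi> (- int p)"
proof -
  let ?s = "\<lambda>_. 1 :: int"
  let ?w = "map Tail [0..<p + q] @ map Head (rev [0..<p] @ rev [p..<p + q])"
  have tail: "height ?s ?w (Tail i) = int i" if "i < p + q" for i
  proof -
    have "[0..<p + q] = [0..<i] @ i # [Suc i..<p + q]"
      using upt_add_eq_append[of 0 i "p + q - i"] upt_conv_Cons[OF that] that by simp
    then show ?thesis using that by auto
  qed
  have head: "height ?s (map Head (rev [a..<b])) (Head i) = - int (b - Suc i)" if "a \<le> i" "i < b" for a b i
  proof -
    have "[a..<b] = [a..<i] @ i # [Suc i..<b]"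
      using upt_add_eq_append[of a i "b - i"] upt_conv_Cons[of i b] that by simp
    then show ?thesis using that by auto
  qed
  have "chord_index ?s ?w i = int q" if "i < p" for i
    using that tail[of i] head[of 0 i p] by (auto simp: chord_index_def)
  moreover have "chord_index ?s ?w i = - int p" if "p \<le> i" "i < p + q" for i
    using that tail[of i] head[of p i "p + q"] by (auto simp: chord_index_def)
  moreover have "chords ?w = {0..<p} \<union> {p..<p + q}" by auto
  moreover have "{0..<p} \<inter> {p..<p + q} = {}" by auto
  ultimately show ?thesis
    by (simp add: index_sum_def clasped_def one_bridge_def sum.union_disjoint)
qed

definition knot :: "nat \<Rightarrow> nat \<Rightarrow> nat \<Rightarrow> virtual_knot" where
  "knot p q j = isotopy `` {clasped p q j}"

definition knot_homotopy_class :: "nat \<times> nat \<Rightarrow> virtual_knot set" where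
  "knot_homotopy_class = (\<lambda>(p, q). homotopic `` {knot p q 0})"

lemma knot_virtual_knot: "knot p q j \<in> virtual_knots"
  unfolding knot_def virtual_knots_def using clasped_gauss_diagram by (rule quotientI)

lemma clasped_in_knot: "clasped p q j \<in> knot p q j"
  using clasped_gauss_diagram by (simp add: knot_def isotopy_def)

lemma knot_index_sum:
  assumes "D \<in> knot p q j" "\<phi> 0 = 0"
  shows "index_sum \<phi> D = index_sum \<phi> (clasped p q j)"
  using assms by (intro index_sum_isotopy) (simp_all add: knot_def)

lemma knot_positive_writhe:
  assumes "D \<in> knot p q j"
  shows "positive_writhe D = positive_writhe (clasped p q 0) + int j"
  using knot_index_sum[OF assms] positive_writhe_clasped[of p q j] by (simp add: positive_writhe_def)

lemma knot_in_class: "knot p q j \<in> knot_homotopy_class (p, q)"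
proof -
  have "homotopy j (clasped p q 0) (clasped p q j)"
    using homotopy_clasped[of j p q 0] by simp
  then have "\<exists>D\<in>knot p q 0. \<exists>D'\<in>knot p q j. \<exists>n. homotopy n D D'"
    using clasped_in_knot by metis
  then show ?thesis
    using knot_virtual_knot by (simp add: knot_homotopy_class_def homotopic_def)
qed

lemma inj_knot: "inj (knot p q)"
proof (rule injI)
  fix i j assume "knot p q i = knot p q j"
  then have "clasped p q i \<in> knot p q j" using clasped_in_knot[of p q i] by simp
  then show "i = j"
    using knot_positive_writhe[of _ p q j] knot_positive_writhe[OF clasped_in_knot[of p q i]] by simp
qed

text \<open>
  The coefficient of \<open>t ^ n\<close> in the \<open>u\<close>-polynomial of the underlying flat knot.
\<close>

definition flat_writhe :: "nat \<Rightarrow> diagram \<Rightarrow> int" where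
  "flat_writhe n = index_sum (\<lambda>k. of_bool (k = int n) - of_bool (k = - int n))"

lemma flat_writhe_homotopy:
  assumes "homotopy m D D'"
  shows "flat_writhe n D' = flat_writhe n D"
proof -
  have "- k = int n \<longleftrightarrow> k = - int n" for k by linarith
  then show ?thesis
    unfolding flat_writhe_def by (intro index_sum_homotopy[OF assms]) simp
qed

lemma flat_writhe_clasped:
  assumes "n > 0" "p > 0" "q > 0"
  shows "flat_writhe n (clasped p q j) = int p * of_bool (n = q) - int q * of_bool (n = p)"
proof -
  have "flat_writhe n (clasped p q j) = flat_writhe n (clasped p q 0)"
    using flat_writhe_homotopy[OF homotopy_clasped[of j p q 0]] by simp
  also have "\<dots> = int p * of_bool (n = q) - int q * of_bool (n = p)"
    using assms by (auto simp: flat_writhe_def index_sum_clasped_0 of_bool_def)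
  finally show ?thesis .
qed

lemma flat_writhe_knot:
  assumes "D \<in> knot p q j" "n > 0" "p > 0" "q > 0"
  shows "flat_writhe n D = int p * of_bool (n = q) - int q * of_bool (n = p)"
  using knot_index_sum[OF assms(1)] flat_writhe_clasped[OF assms(2-4)] assms(2)
  by (simp add: flat_writhe_def)

text \<open>
  Every diagram of the knot inherits a nonzero \<open>flat_writhe q\<close>, so it has a chord and thereby a bridge.
\<close>

lemma vb_knot:
  assumes "p > 0" "q > 0" "p \<noteq> q"
  shows "vb (knot p q j) = 1"
proof -
  have pos: "bridges D > 0" if "D \<in> knot p q j" for D
  proof -
    obtain w s where D: "D = (w, s)" by (cases D)
    have "flat_writhe q D = int p"
      using flat_writhe_knot[OF that assms(2,1,2)] assms(3) by simp
    then have "w \<noteq> []" using assms(1) D by (auto simp: flat_writhe_def index_sum_def)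
    moreover have "D \<in> gauss_diagrams" using that by (simp add: knot_def isotopy_def)
    ultimately show ?thesis using bridges_pos D by simp
  qed
  have "bridges (clasped p q j) = 1"
    using bridges_one_bridge pos[OF clasped_in_knot] unfolding clasped_def by (metis One_nat_def Suc_leI le_antisym)
  then show ?thesis
    unfolding vb_def using clasped_in_knot pos by (intro Least_equality) (auto simp: Suc_le_eq)
qed

lemma rvu_knot: "int (rvu (knot p q i) (knot p q j)) = \<bar>int i - int j\<bar>"
proof -
  let ?d = "nat \<bar>int i - int j\<bar>"
  have "homotopy ?d (clasped p q i) (clasped p q j)"
  proof (cases "i \<le> j")
    case True
    then have "?d = j - i" "i + (j - i) = j" by linarith+
    then show ?thesis using homotopy_clasped[of "j - i" p q i] by metis
  next
    case False
    then have "?d = i - j" "j + (i - j) = i" by linarith+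
    then show ?thesis using homotopy_sym[OF homotopy_clasped[of "i - j" p q j]] by metis
  qed
  then have "\<exists>D\<in>knot p q i. \<exists>D'\<in>knot p q j. homotopy ?d D D'"
    using clasped_in_knot by metis
  moreover have "?d \<le> n" if "\<exists>D\<in>knot p q i. \<exists>D'\<in>knot p q j. homotopy n D D'" for n
  proof -
    from that obtain D D' where D: "D \<in> knot p q i" "D' \<in> knot p q j" "homotopy n D D'" by blast
    then show ?thesis
      using positive_writhe_homotopy[OF D(3)] knot_positive_writhe[OF D(1)]
        knot_positive_writhe[OF D(2)] by simp
  qed
  ultimately have "rvu (knot p q i) (knot p q j) = ?d"
    unfolding rvu_def by (rule Least_equality)
  then show ?thesis by simp
qed

text \<open>
  The only positive coefficient of the \<open>u\<close>-polynomial \<open>p * t ^ q - q * t ^ p\<close> is \<open>p\<close>, at degree \<open>q\<close>.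
\<close>

lemma inj_on_knot_homotopy_class:
  "inj_on knot_homotopy_class {(p, q). 0 < p \<and> 0 < q \<and> p \<noteq> q}"
proof (rule inj_onI, clarify)
  fix p q p' q' :: nat
  assume pos: "0 < p" "0 < q" "p \<noteq> q" "0 < p'" "0 < q'" "p' \<noteq> q'"
    and eq: "knot_homotopy_class (p, q) = knot_homotopy_class (p', q')"
  have "knot p' q' 0 \<in> knot_homotopy_class (p, q)" using knot_in_class eq by simp
  then obtain D D' n where D: "D \<in> knot p q 0" "D' \<in> knot p' q' 0" "homotopy n D D'"
    by (auto simp: knot_homotopy_class_def homotopic_def)
  have "int p = int p' * of_bool (q = q') - int q' * of_bool (q = p')"
    using flat_writhe_homotopy[OF D(3), of q] flat_writhe_knot[OF D(1), of q]
      flat_writhe_knot[OF D(2), of q] pos by simp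
  then show "p = p' \<and> q = q'" using pos by (auto simp: of_bool_def split: if_splits)
qed

theorem theorem2p6:
  "\<exists>H :: nat \<times> nat \<Rightarrow> virtual_knot set.
     inj_on H {(p, q). 0 < p \<and> 0 < q \<and> p \<noteq> q} \<and>
     infinite (H ` {(p, q). 0 < p \<and> 0 < q \<and> p \<noteq> q}) \<and>
     (\<forall>p q. 0 < p \<and> 0 < q \<and> p \<noteq> q \<longrightarrow>
        H (p, q) \<in> homotopy_classes \<and>
        (\<exists>K :: nat \<Rightarrow> virtual_knot.
           inj K \<and>
           (\<forall>j. K j \<in> H (p, q)) \<and>
           (\<forall>j. vb (K j) = 1) \<and>
           (\<forall>j1 j2. int (rvu (K j1) (K j2)) = \<bar>int j1 - int j2\<bar>)))"
proof (intro exI[of _ knot_homotopy_class] conjI allI impI)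
  let ?I = "{(p, q). 0 < p \<and> 0 < q \<and> p \<noteq> (q :: nat)}"
  show "inj_on knot_homotopy_class ?I" by (rule inj_on_knot_homotopy_class)
  have "inj (\<lambda>n :: nat. (Suc n, Suc (Suc n)))" by (simp add: inj_on_def)
  then have "infinite (range (\<lambda>n :: nat. (Suc n, Suc (Suc n))))"
    using finite_imageD infinite_UNIV_nat by blast
  moreover have "range (\<lambda>n :: nat. (Suc n, Suc (Suc n))) \<subseteq> ?I" by auto
  ultimately have "infinite ?I" by (rule infinite_super[rotated])
  then show "infinite (knot_homotopy_class ` ?I)"
    by (simp add: finite_image_iff[OF inj_on_knot_homotopy_class])
next
  fix p q :: nat
  show "knot_homotopy_class (p, q) \<in> homotopy_classes"
    using knot_virtual_knot by (simp add: knot_homotopy_class_def homotopy_classes_def quotientI)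
next
  fix p q :: nat
  assume "0 < p \<and> 0 < q \<and> p \<noteq> q"
  then show "\<exists>K. inj K \<and> (\<forall>j. K j \<in> knot_homotopy_class (p, q)) \<and> (\<forall>j. vb (K j) = 1) \<and>
      (\<forall>j1 j2. int (rvu (K j1) (K j2)) = \<bar>int j1 - int j2\<bar>)"
    by (intro exI[of _ "knot p q"]) (simp add: inj_knot knot_in_class vb_knot rvu_knot)
qed

end
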